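(* Every fixed prime ideal of $\mathbb{K}\langle z\rangle$ is a maximal ideal.
   Context: $\mathbb{K}\langle z\rangle$ denotes any one of the following three rings (the statement is meant for each of them): (1) the ring $\mathbb{C}\langle z\rangle$ of complex entire functions of one variable; (2) the ring $\mathbb{C}\langle x\rangle$ of convergent power series $\sum_{n\ge 0}a_nz^n$ in one complex variable $z\in\mathbb{C}$ with real coefficients $a_n\in\mathbb{R}$; (3) the ring $\mathbb{R}\langle x\rangle$ of real analytic functions of one real variable (functions on $\mathbb{R}$ given locally by convergent real power series). $\mathbb{K}$ is the underlying field: $\mathbb{C}$ in cases (1), (2) and $\mathbb{R}$ in case (3). For $f\in\mathbb{K}\langle z\rangle$, $Z_f\subseteq\mathbb{K}$ is the zero set of $f$, and for an ideal $I$, $Z[I]=\{Z_f: f\in I\}$. An ideal $I$ is fixed if $\bigcap Z[I]\neq\emptyset$, i.e. all functions in $I$ have a common zero in $\mathbb{K}$.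
   Formalization: The prime ideal is assumed to be non-zero: the zero ideal is prime and fixed (the zero function vanishes everywhere) but not maximal in any of the three rings, so the statement fails for it as written. *)

theory Defs
  imports "HOL-Complex_Analysis.Complex_Analysis" "HOL-Algebra.Ideal"
begin

definition function_ring :: "('a \<Rightarrow> 'b::comm_ring_1) set \<Rightarrow> ('a \<Rightarrow> 'b) ring" where
  "function_ring A =
     \<lparr>carrier = A, monoid.mult = (\<lambda>f g x. f x * g x), one = (\<lambda>_. 1),
      zero = (\<lambda>_. 0), add = (\<lambda>f g x. f x + g x)\<rparr>"

definition entire_ring :: "(complex \<Rightarrow> complex) ring" where
  "entire_ring = function_ring {f. f holomorphic_on UNIV}"

text \<open>
  A series with real coefficients that is required to converge on all of \<open>\<complex>\<close>, so that zero
  sets (including non-real zeros) are subsets of \<open>\<complex>\<close>; the ring elements are its sum functions.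
\<close>
definition real_coeff_entire_ring :: "(complex \<Rightarrow> complex) ring" where
  "real_coeff_entire_ring =
     function_ring {f. \<exists>a :: nat \<Rightarrow> real. \<forall>z. (\<lambda>n. of_real (a n) * z ^ n) sums f z}"

text \<open>
  \<^const>\<open>has_fps_expansion\<close> demands a positive radius of convergence and agreement of the
  function with the sum of the series near \<open>0\<close>; the translation moves the centre to \<open>x\<close>.
\<close>
definition real_analytic_ring :: "(real \<Rightarrow> real) ring" where
  "real_analytic_ring =
     function_ring {f. \<forall>x. \<exists>F :: real fps. (\<lambda>h. f (x + h)) has_fps_expansion F}"

definition zero_set :: "('a \<Rightarrow> 'b::zero) \<Rightarrow> 'a set" where
  "zero_set f = {x. f x = 0}"

text \<open>
  The zero ideal satisfies this predicate, since \<^term>\<open>zero_set (\<lambda>_. 0) = UNIV\<close>. As the rings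
  above are integral domains but not fields, it is also prime and not maximal; statements
  about fixed prime ideals being maximal therefore concern non-zero ideals.
\<close>
definition fixed_ideal :: "('a \<Rightarrow> 'b::zero) set \<Rightarrow> bool" where
  "fixed_ideal I \<longleftrightarrow> \<Inter> (zero_set ` I) \<noteq> {}"

text \<open>
  \<^locale>\<open>primeideal\<close> includes \<^locale>\<open>cring\<close>; the following facts show that this
  is no extra restriction for the three rings.
\<close>

lemma cring_function_ring:
  assumes add: "\<And>f g. f \<in> A \<Longrightarrow> g \<in> A \<Longrightarrow> (\<lambda>x. f x + g x) \<in> A"
    and mult: "\<And>f g. f \<in> A \<Longrightarrow> g \<in> A \<Longrightarrow> (\<lambda>x. f x * g x) \<in> A"
    and const: "(\<lambda>_. 0) \<in> A" "(\<lambda>_. 1) \<in> A" "(\<lambda>_. - 1) \<in> A"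
  shows "cring (function_ring A)"
proof (rule cringI)
  have neg: "(\<lambda>x. - f x) \<in> A" if "f \<in> A" for f
    using mult[OF const(3) that] by simp
  show "abelian_group (function_ring A)"
  proof (rule abelian_groupI)
    fix f assume "f \<in> carrier (function_ring A)"
    then show "\<exists>g\<in>carrier (function_ring A). g \<oplus>\<^bsub>function_ring A\<^esub> f = \<zero>\<^bsub>function_ring A\<^esub>"
      by (intro bexI[of _ "\<lambda>x. - f x"]) (auto simp: function_ring_def neg)
  qed (auto simp: function_ring_def add const algebra_simps)
  show "comm_monoid (function_ring A)"
    by (rule comm_monoidI) (auto simp: function_ring_def mult const algebra_simps)
qed (auto simp: function_ring_def algebra_simps)

lemma cring_entire_ring: "cring entire_ring"
  unfolding entire_ring_def by (rule cring_function_ring) (auto intro: holomorphic_intros)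

lemma cring_real_coeff_entire_ring: "cring real_coeff_entire_ring"
  unfolding real_coeff_entire_ring_def
proof (rule cring_function_ring)
  let ?A = "{f. \<exists>a :: nat \<Rightarrow> real. \<forall>z::complex. (\<lambda>n. of_real (a n) * z ^ n) sums f z}"
  fix f g :: "complex \<Rightarrow> complex" assume "f \<in> ?A" "g \<in> ?A"
  then obtain a b :: "nat \<Rightarrow> real"
    where a: "\<And>z. (\<lambda>n. of_real (a n) * z ^ n) sums f z"
      and b: "\<And>z. (\<lambda>n. of_real (b n) * z ^ n) sums g z" by auto
  have "(\<lambda>n. of_real (a n + b n) * z ^ n) sums (f z + g z)" for z
    using sums_add[OF a[of z] b[of z]] by (simp add: algebra_simps)
  then show "(\<lambda>z. f z + g z) \<in> ?A"
    by (intro CollectI exI[of _ "\<lambda>n. a n + b n"] allI)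
  have norm_summable: "summable (\<lambda>n. norm (of_real (c n) * z ^ n :: complex))"
    if "\<And>z. (\<lambda>n. of_real (c n) * z ^ n) sums h z"
    for c :: "nat \<Rightarrow> real" and h :: "complex \<Rightarrow> complex" and z
  proof (rule powser_insidea)
    show "summable (\<lambda>n. of_real (c n) * (of_real (norm z + 1) :: complex) ^ n)"
      using that by (rule sums_summable)
    have "norm (of_real (norm z + 1) :: complex) = \<bar>norm z + 1\<bar>" by (rule norm_of_real)
    then show "norm z < norm (of_real (norm z + 1) :: complex)" by simp
  qed
  have "(\<lambda>n. of_real (\<Sum>i\<le>n. a i * b (n - i)) * z ^ n) sums (f z * g z)" for z
  proof -
    have "(\<lambda>n. \<Sum>i\<le>n. (of_real (a i) * z ^ i) * (of_real (b (n - i)) * z ^ (n - i)))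
            sums (f z * g z)"
      using Cauchy_product_sums[OF norm_summable[OF a, of z] norm_summable[OF b, of z]]
      by (simp add: sums_unique[OF a, symmetric] sums_unique[OF b, symmetric])
    moreover have "(\<Sum>i\<le>n. (of_real (a i) * z ^ i) * (of_real (b (n - i)) * z ^ (n - i)))
        = of_real (\<Sum>i\<le>n. a i * b (n - i)) * z ^ n" for n
      unfolding of_real_sum sum_distrib_right
    proof (rule sum.cong[OF refl])
      fix i assume "i \<in> {..n}"
      then have "z ^ n = z ^ i * z ^ (n - i)"
        by (simp flip: power_add)
      then show "(of_real (a i) * z ^ i) * (of_real (b (n - i)) * z ^ (n - i))
          = of_real (a i * b (n - i)) * z ^ n"
        by (simp only: of_real_mult mult_ac)
    qed
    ultimately show ?thesis by simp
  qed
  then show "(\<lambda>z. f z * g z) \<in> ?A"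
    by (intro CollectI exI[of _ "\<lambda>n. \<Sum>i\<le>n. a i * b (n - i)"] allI)
next
  have const: "\<exists>a :: nat \<Rightarrow> real. \<forall>z::complex. (\<lambda>n. of_real (a n) * z ^ n) sums of_real c" for c
  proof (intro exI allI)
    fix z :: complex
    show "(\<lambda>n. of_real (if n = 0 then c else 0) * z ^ n) sums of_real c"
      using sums_finite[of "{0}" "\<lambda>n. of_real (if n = 0 then c else 0) * z ^ n"] by simp
  qed
  show "(\<lambda>_. 0) \<in> {f. \<exists>a :: nat \<Rightarrow> real. \<forall>z::complex. (\<lambda>n. of_real (a n) * z ^ n) sums f z}"
    using const[of 0] by simp
  show "(\<lambda>_. 1) \<in> {f. \<exists>a :: nat \<Rightarrow> real. \<forall>z::complex. (\<lambda>n. of_real (a n) * z ^ n) sums f z}"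
    using const[of 1] by simp
  show "(\<lambda>_. - 1) \<in> {f. \<exists>a :: nat \<Rightarrow> real. \<forall>z::complex. (\<lambda>n. of_real (a n) * z ^ n) sums f z}"
    using const[of "- 1"] by simp
qed

lemma cring_real_analytic_ring: "cring real_analytic_ring"
  unfolding real_analytic_ring_def
proof (rule cring_function_ring)
  have const: "\<exists>F. (\<lambda>_. c) has_fps_expansion F" for c :: real
    using has_fps_expansion_const by blast
  show "(\<lambda>_. 0) \<in> {f. \<forall>x. \<exists>F :: real fps. (\<lambda>h. f (x + h)) has_fps_expansion F}"
    "(\<lambda>_. 1) \<in> {f. \<forall>x. \<exists>F :: real fps. (\<lambda>h. f (x + h)) has_fps_expansion F}"
    "(\<lambda>_. - 1) \<in> {f. \<forall>x. \<exists>F :: real fps. (\<lambda>h. f (x + h)) has_fps_expansion F}"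
    by (simp_all add: const)
qed (use has_fps_expansion_add has_fps_expansion_mult in fastforce)+

end

theory Submission
  imports Defs
begin

text \<open>
  A fixed prime ideal \<open>I \<noteq> 0\<close> turns out to be the kernel of evaluation at a common zero \<open>p\<close>.
  In each of the three rings this kernel is a principal ideal \<open>(q)\<close>: one takes \<open>q = z - p\<close>, except
  that in the ring of real power series a non-real \<open>p\<close> forces the conjugate zero as well, so that
  there \<open>q = (z - p) (z - cnj p)\<close>.

  To see that \<open>q \<in> I\<close>, start with some \<open>f \<in> I\<close> other than \<open>0\<close>. As \<open>f\<close> vanishes at \<open>p\<close>, it is
  \<open>q g\<close> for some \<open>g\<close> in the ring, and as \<open>I\<close> is prime, \<open>q \<in> I\<close> or \<open>g \<in> I\<close>. In the second case
  repeat the step with \<open>g\<close>, whose order of vanishing at \<open>p\<close> is smaller. That order is finite for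
  \<open>f \<noteq> 0\<close> by the identity theorem, so the process ends
  (\<open>generator_in_prime_ideal\<close>). Hence \<open>I\<close> contains every function that vanishes at \<open>p\<close>.
  An ideal that properly contains \<open>I\<close> has a member \<open>h\<close> with \<open>h p \<noteq> 0\<close>; the ring contains a
  function \<open>k\<close> with \<open>h p * k p = 1\<close>, so \<open>1 - h k\<close> lies in \<open>I\<close>, and \<open>1\<close> lies in the larger ideal
  (\<open>fixed_primeideal_maximal\<close>).

  Order of vanishing, identity theorem and division by \<open>z - p\<close> need only local power series and
  the connectedness of the field, so they are proved once for \<open>\<real>\<close> and \<open>\<complex>\<close>. The ring of real
  power series consists of the entire functions that commute with conjugation, and a quotient
  in that ring is obtained by symmetrising the entire quotient.
\<close>

section \<open>Functions with local power series expansions\<close>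

definition everywhere_analytic :: "('a :: {banach,real_normed_field} \<Rightarrow> 'a) set" where
  "everywhere_analytic = {f. \<forall>x. \<exists>F. (\<lambda>h. f (x + h)) has_fps_expansion F}"

lemma everywhere_analyticD:
  assumes "f \<in> everywhere_analytic"
  obtains F where "(\<lambda>h. f (x + h)) has_fps_expansion F"
  using assms by (auto simp: everywhere_analytic_def)

lemma everywhere_analytic_const: "(\<lambda>_. c) \<in> everywhere_analytic"
  unfolding everywhere_analytic_def using has_fps_expansion_const by blast

lemma has_fps_expansion_translated_linear:
  fixes x p :: "'a :: {banach,real_normed_field}"
  shows "(\<lambda>h. x + h - p) has_fps_expansion fps_const (x - p) + fps_X"
proof -
  have "(\<lambda>h. (x - p) + h) has_fps_expansion fps_const (x - p) + fps_X"
    by (intro fps_expansion_intros)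
  then show ?thesis
    by (simp add: algebra_simps)
qed

lemma everywhere_analytic_linear: "(\<lambda>x. x - p) \<in> everywhere_analytic"
  unfolding everywhere_analytic_def using has_fps_expansion_translated_linear by blast

lemma nonzero_fps_expansion_imp_isolated_zero:
  fixes f :: "'a :: {banach,real_normed_field} \<Rightarrow> 'a"
  assumes f: "f has_fps_expansion F" and "F \<noteq> 0"
  shows "eventually (\<lambda>h. f h \<noteq> 0) (at 0)"
proof -
  \<comment> \<open>Near \<open>0\<close>, the function is \<open>h ^ subdegree F\<close> times a continuous function that is non-zero at \<open>0\<close>.\<close>
  define n where "n = subdegree F"
  define g where "g = (\<lambda>h. if h = 0 then fps_nth F n else f h / h ^ n)"
  have "g has_fps_expansion fps_shift n F"
    unfolding g_def n_def using f by (rule has_fps_expansion_shift) auto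
  then have "continuous (at 0) g"
    by (rule has_fps_expansion_imp_continuous)
  moreover have "g 0 \<noteq> 0"
    using \<open>F \<noteq> 0\<close> by (simp add: g_def n_def)
  ultimately have "eventually (\<lambda>h. g h \<noteq> 0) (at 0)"
    using tendsto_imp_eventually_ne[of g "g 0" "at 0" 0] by (simp add: continuous_within)
  moreover have "eventually (\<lambda>h::'a. h \<noteq> 0) (at 0)"
    by (simp add: eventually_at_filter)
  ultimately show ?thesis
    by eventually_elim (auto simp: g_def)
qed

lemma has_fps_expansion_unique:
  fixes f :: "'a :: {banach,real_normed_field} \<Rightarrow> 'a"
  assumes "f has_fps_expansion F" "f has_fps_expansion G"
  shows "F = G"
proof (rule ccontr)
  assume "F \<noteq> G"
  then have "eventually (\<lambda>h::'a. f h - f h \<noteq> 0) (at 0)"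
    using nonzero_fps_expansion_imp_isolated_zero[OF has_fps_expansion_diff[OF assms]] by simp
  then show False
    by simp
qed

lemma eventually_nhds_translate:
  fixes x :: "'a :: real_normed_vector"
  shows "eventually (\<lambda>h. P (x + h)) (nhds 0) \<longleftrightarrow> eventually P (nhds x)"
proof -
  have "nhds x = filtermap (\<lambda>h. h + x) (nhds 0)"
    using filtermap_nhds_shift[of "- x" 0] by simp
  then show ?thesis
    by (simp add: eventually_filtermap add.commute)
qed

text \<open>
  The points near which \<open>f\<close> is identically zero form an open set. Its complement is open too,
  because at a point with a non-zero expansion the zeros of \<open>f\<close> cannot accumulate.
\<close>
lemma everywhere_analytic_identity:
  fixes f :: "'a :: {banach,real_normed_field} \<Rightarrow> 'a"
  assumes f: "f \<in> everywhere_analytic" and p: "(\<lambda>h. f (p + h)) has_fps_expansion 0"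
  shows "f = (\<lambda>_. 0)"
proof -
  define S where "S = {x. eventually (\<lambda>y. f y = 0) (nhds x)}"
  have "p \<in> S"
    using p eventually_nhds_translate[of "\<lambda>y. f y = 0" p]
    by (simp add: S_def has_fps_expansion_0_iff)
  have "open S"
  proof (subst open_subopen, intro ballI)
    fix x assume "x \<in> S"
    then obtain T where "open T" "x \<in> T" "\<forall>y\<in>T. f y = 0"
      by (auto simp: S_def eventually_nhds)
    then show "\<exists>T. open T \<and> x \<in> T \<and> T \<subseteq> S"
      by (intro exI[of _ T]) (auto simp: S_def eventually_nhds)
  qed
  moreover have "open (- S)"
  proof (subst open_subopen, intro ballI)
    fix x assume "x \<in> - S"
    obtain F where F: "(\<lambda>h. f (x + h)) has_fps_expansion F"
      using f by (rule everywhere_analyticD)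
    have "F \<noteq> 0"
      using F \<open>x \<in> - S\<close> eventually_nhds_translate[of "\<lambda>y. f y = 0" x]
      by (auto simp: S_def has_fps_expansion_0_iff)
    from nonzero_fps_expansion_imp_isolated_zero[OF F this]
    have "eventually (\<lambda>h. x + h \<noteq> x \<longrightarrow> f (x + h) \<noteq> 0) (nhds 0)"
      by (simp add: eventually_at_filter)
    then have "eventually (\<lambda>y. y \<noteq> x \<longrightarrow> f y \<noteq> 0) (nhds x)"
      using eventually_nhds_translate[of "\<lambda>y. y \<noteq> x \<longrightarrow> f y \<noteq> 0" x] by simp
    then obtain T where T: "open T" "x \<in> T" "\<forall>y\<in>T. y \<noteq> x \<longrightarrow> f y \<noteq> 0"
      by (auto simp: eventually_nhds)
    have "T \<subseteq> - S"
    proof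
      fix y assume "y \<in> T"
      show "y \<in> - S"
      proof (cases "y = x")
        case False
        then have "f y \<noteq> 0"
          using T \<open>y \<in> T\<close> by auto
        then show ?thesis
          by (auto simp: S_def dest: eventually_nhds_x_imp_x)
      qed (use \<open>x \<in> - S\<close> in simp)
    qed
    then show "\<exists>T. open T \<and> x \<in> T \<and> T \<subseteq> - S"
      using T by blast
  qed
  ultimately have "S = UNIV"
    using \<open>p \<in> S\<close> connected_UNIV[where 'a='a] unfolding connected_clopen
    by (auto simp: closed_def)
  then show ?thesis
    by (auto simp: S_def dest: eventually_nhds_x_imp_x)
qed

lemma everywhere_analytic_divide_linear:
  fixes f :: "'a :: {banach,real_normed_field} \<Rightarrow> 'a"
  assumes f: "f \<in> everywhere_analytic" and "f p = 0"
  shows "\<exists>g\<in>everywhere_analytic. f = (\<lambda>x. (x - p) * g x)"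
proof -
  obtain F where F: "(\<lambda>h. f (p + h)) has_fps_expansion F"
    using f by (rule everywhere_analyticD)
  define g where "g = (\<lambda>x. if x = p then fps_nth F 1 else f x / (x - p))"
  have "\<exists>G. (\<lambda>h. g (x + h)) has_fps_expansion G" for x
  proof (cases "x = p")
    case True
    have "fps_nth F 0 = 0"
      using has_fps_expansion_imp_0_eq_fps_nth_0[OF F] \<open>f p = 0\<close> by simp
    show ?thesis
    proof (cases "F = 0")
      case True
      \<comment> \<open>The zero series has subdegree \<open>0\<close>, so the shift rule below does not cover it.\<close>
      then have "f = (\<lambda>_. 0)"
        using everywhere_analytic_identity f F by blast
      then show ?thesis
        using True has_fps_expansion_0 by (intro exI[of _ 0]) (simp add: g_def cong: if_cong)
    next
      case False
      then have "1 \<le> subdegree F"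
        using \<open>fps_nth F 0 = 0\<close> by (metis nth_subdegree_nonzero less_one not_less)
      then have "(\<lambda>h. if h = 0 then fps_nth F 1 else f (p + h) / h ^ 1) has_fps_expansion fps_shift 1 F"
        using F by (intro has_fps_expansion_shift) auto
      then show ?thesis
        using \<open>x = p\<close> by (intro exI[of _ "fps_shift 1 F"]) (simp add: g_def cong: if_cong)
    qed
  next
    case False
    obtain H where H: "(\<lambda>h. f (x + h)) has_fps_expansion H"
      using f by (rule everywhere_analyticD)
    have "(\<lambda>h. f (x + h) / (x + h - p)) has_fps_expansion H / (fps_const (x - p) + fps_X)"
      using H has_fps_expansion_translated_linear by (rule has_fps_expansion_divide') (use False in simp)
    moreover have "eventually (\<lambda>y. y \<noteq> p) (nhds x)"
      using False by (rule t1_space_nhds)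
    then have "eventually (\<lambda>h. x + h \<noteq> p) (nhds 0)"
      using eventually_nhds_translate[of "\<lambda>y. y \<noteq> p" x] by simp
    then have "eventually (\<lambda>h. f (x + h) / (x + h - p) = g (x + h)) (nhds 0)"
      by eventually_elim (simp add: g_def)
    ultimately have "(\<lambda>h. g (x + h)) has_fps_expansion H / (fps_const (x - p) + fps_X)"
      by (rule iffD1[OF has_fps_expansion_cong[OF _ refl], rotated])
    then show ?thesis
      by blast
  qed
  then have "g \<in> everywhere_analytic"
    by (simp add: everywhere_analytic_def)
  moreover have "f = (\<lambda>x. (x - p) * g x)"
    using \<open>f p = 0\<close> by (auto simp: g_def)
  ultimately show ?thesis
    by blast
qed

section \<open>Prime ideals in rings of analytic functions\<close>

text \<open>
  Dividing \<open>f\<close> by \<open>q\<close> lowers the subdegree of the expansion at \<open>p\<close>, because the expansion of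
  \<open>q\<close> is non-zero without constant term; so the descent from \<open>f\<close> to \<open>g\<close> with \<open>f = q g\<close> ends.
\<close>
lemma generator_in_prime_ideal:
  fixes A :: "('a :: {banach,real_normed_field} \<Rightarrow> 'a) set"
  assumes A: "A \<subseteq> everywhere_analytic"
    and q: "q \<in> A" "q p = 0" "q \<noteq> (\<lambda>_. 0)"
    and divide: "\<And>f. f \<in> A \<Longrightarrow> f p = 0 \<Longrightarrow> \<exists>g\<in>A. f = (\<lambda>x. q x * g x)"
    and I: "primeideal I (function_ring A)"
    and zero: "\<And>f. f \<in> I \<Longrightarrow> f p = 0"
    and "f \<in> I" "f \<noteq> (\<lambda>_. 0)"
  shows "q \<in> I"
proof -
  interpret primeideal I "function_ring A"
    by (rule I)
  obtain Q where Q: "(\<lambda>h. q (p + h)) has_fps_expansion Q"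
    using A q everywhere_analyticD by blast
  have "Q \<noteq> 0"
    using everywhere_analytic_identity[of q p] A q Q by auto
  moreover have "fps_nth Q 0 = 0"
    using has_fps_expansion_imp_0_eq_fps_nth_0[OF Q] q by simp
  ultimately have "0 < subdegree Q"
    by (metis nth_subdegree_nonzero gr0I)
  have descent: "q \<in> I"
    if "f \<in> I" "f \<noteq> (\<lambda>_. 0)" "(\<lambda>h. f (p + h)) has_fps_expansion F" for f F
    using that
  proof (induction "subdegree F" arbitrary: f F rule: less_induct)
    case less
    have "f \<in> A"
      using a_subset less.prems(1) by (auto simp: function_ring_def)
    then obtain g where g: "g \<in> A" "f = (\<lambda>x. q x * g x)"
      using divide zero less.prems(1) by blast
    show "q \<in> I"
    proof (cases "g \<in> I")
      case False
      then show ?thesis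
        using I_prime[of q g] less.prems(1) g q by (auto simp: function_ring_def)
    next
      case True
      obtain G where G: "(\<lambda>h. g (p + h)) has_fps_expansion G"
        using A g everywhere_analyticD by blast
      have "F = Q * G"
        using has_fps_expansion_unique[OF less.prems(3)] has_fps_expansion_mult[OF Q G] g by simp
      moreover have "F \<noteq> 0"
        using everywhere_analytic_identity[of f p] A \<open>f \<in> A\<close> less.prems by auto
      ultimately have "subdegree G < subdegree F"
        using \<open>0 < subdegree Q\<close> by (auto simp: subdegree_mult)
      moreover have "g \<noteq> (\<lambda>_. 0)"
        using g less.prems(2) by auto
      ultimately show ?thesis
        using less.hyps True G by blast
    qed
  qed
  have "f \<in> A"
    using a_subset \<open>f \<in> I\<close> by (auto simp: function_ring_def)
  then obtain F where "(\<lambda>h. f (p + h)) has_fps_expansion F"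
    using A everywhere_analyticD by blast
  then show ?thesis
    using descent \<open>f \<in> I\<close> \<open>f \<noteq> (\<lambda>_. 0)\<close> by blast
qed

text \<open>
  The last hypothesis makes the values at \<open>p\<close> of functions in \<open>A\<close> a field, so that the kernel
  of evaluation at \<open>p\<close>, which is contained in \<open>I\<close>, is already maximal.
\<close>
lemma fixed_primeideal_maximal:
  fixes A :: "('a :: {banach,real_normed_field} \<Rightarrow> 'a) set"
  assumes A: "A \<subseteq> everywhere_analytic"
    and I: "primeideal I (function_ring A)" "I \<noteq> {\<zero>\<^bsub>function_ring A\<^esub>}"
    and zero: "\<And>f. f \<in> I \<Longrightarrow> f p = 0"
    and q: "q \<in> A" "q p = 0" "q \<noteq> (\<lambda>_. 0)"
    and divide: "\<And>f. f \<in> A \<Longrightarrow> f p = 0 \<Longrightarrow> \<exists>g\<in>A. f = (\<lambda>x. q x * g x)"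
    and unit: "\<And>f. f \<in> A \<Longrightarrow> f p \<noteq> 0 \<Longrightarrow> \<exists>k\<in>A. f p * k p = 1"
  shows "maximalideal I (function_ring A)"
proof -
  interpret primeideal I "function_ring A"
    by (rule I)
  let ?R = "function_ring A"
  have carrier: "carrier ?R = A"
    by (simp add: function_ring_def)
  obtain f where "f \<in> I" "f \<noteq> (\<lambda>_. 0)"
    using I(2) additive_subgroup.zero_closed[OF additive_subgroup_axioms]
    by (auto simp: function_ring_def)
  then have "q \<in> I"
    by (intro generator_in_prime_ideal[OF A q _ I(1), where f = f]) (simp_all add: divide zero)
  have kernel: "h \<in> I" if h: "h \<in> A" "h p = 0" for h
  proof -
    obtain g where "g \<in> A" "h = (\<lambda>x. q x * g x)"
      using divide h by blast
    then show ?thesis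
      using I_r_closed[OF \<open>q \<in> I\<close>, of g] by (simp add: function_ring_def)
  qed
  show ?thesis
  proof (rule maximalidealI)
    show "ideal I ?R"
      by (rule ideal_axioms)
    show "carrier ?R \<noteq> I"
      by (rule I_notcarr)
    fix J assume J: "ideal J ?R" "I \<subseteq> J" "J \<subseteq> carrier ?R"
    interpret J: ideal J ?R
      by (rule J)
    show "J = I \<or> J = carrier ?R"
    proof (cases "\<exists>h\<in>J. h p \<noteq> 0")
      case False
      then show ?thesis
        using kernel J by (auto simp: carrier)
    next
      case True
      then obtain h where h: "h \<in> J" "h p \<noteq> 0"
        by blast
      then obtain k where k: "k \<in> A" "h p * k p = 1"
        using unit J carrier by blast
      let ?m = "h \<otimes>\<^bsub>?R\<^esub> k"
      have mJ: "?m \<in> J"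
        using J.I_r_closed h k by (simp add: carrier)
      then have m: "?m \<in> carrier ?R"
        using J by auto
      let ?d = "\<one>\<^bsub>?R\<^esub> \<ominus>\<^bsub>?R\<^esub> ?m"
      have d: "?d \<in> carrier ?R"
        using m by simp
      have sum: "?d \<oplus>\<^bsub>?R\<^esub> ?m = \<one>\<^bsub>?R\<^esub>"
        using m by (simp add: a_minus_def a_assoc l_neg)
      then have "?d p + h p * k p = 1"
        by (simp add: function_ring_def fun_eq_iff)
      then have "?d p = 0"
        using k by simp
      then have "?d \<in> J"
        using kernel d J by (auto simp: carrier)
      then have "\<one>\<^bsub>?R\<^esub> \<in> J"
        using J.a_closed[OF _ mJ] sum by metis
      then show ?thesis
        using J.one_imp_carrier by simp
    qed
  qed
qed

lemma fixed_idealE: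
  assumes "fixed_ideal I"
  obtains p where "\<And>f. f \<in> I \<Longrightarrow> f p = 0"
  using assms by (auto simp: fixed_ideal_def zero_set_def)

lemma everywhere_analytic_fixed_primeideal_maximal:
  fixes I :: "('a :: {banach,real_normed_field} \<Rightarrow> 'a) set"
  assumes "primeideal I (function_ring everywhere_analytic)"
    and "I \<noteq> {\<zero>\<^bsub>function_ring everywhere_analytic\<^esub>}" and "fixed_ideal I"
  shows "maximalideal I (function_ring everywhere_analytic)"
proof -
  obtain p where "\<And>f. f \<in> I \<Longrightarrow> f p = 0"
    using assms(3) fixed_idealE by blast
  then show ?thesis
  proof (rule fixed_primeideal_maximal[OF order_refl assms(1,2)])
    show "(\<lambda>x. x - p) \<noteq> (\<lambda>_. 0)"
      by (auto simp: fun_eq_iff intro: exI[of _ "p + 1"])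
    fix f :: "'a \<Rightarrow> 'a" assume "f p \<noteq> 0"
    then show "\<exists>k\<in>everywhere_analytic. f p * k p = 1"
      by (intro bexI[of _ "\<lambda>_. inverse (f p)"] everywhere_analytic_const) simp
  qed (simp_all add: everywhere_analytic_linear everywhere_analytic_divide_linear)
qed

section \<open>Entire functions with real coefficients\<close>

lemma everywhere_analytic_complex_iff:
  "f \<in> everywhere_analytic \<longleftrightarrow> f holomorphic_on (UNIV :: complex set)"
proof
  assume "f \<in> everywhere_analytic"
  then have "f analytic_on {z}" for z
    using everywhere_analyticD has_fps_expansion_imp_analytic by metis
  then show "f holomorphic_on UNIV"
    by (simp add: analytic_on_open[symmetric] analytic_on_analytic_at[of f UNIV])
next
  assume "f holomorphic_on UNIV"
  then have "f analytic_on {z}" for z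
    using analytic_on_holomorphic by blast
  then show "f \<in> everywhere_analytic"
    unfolding everywhere_analytic_def using analytic_at_imp_has_fps_expansion by blast
qed

definition conj_symmetric_entire :: "(complex \<Rightarrow> complex) set" where
  "conj_symmetric_entire = {f. f holomorphic_on UNIV \<and> (\<forall>z. f (cnj z) = cnj (f z))}"

text \<open>
  If \<open>f\<close> commutes with conjugation, then averaging its Taylor series at \<open>0\<close> with the conjugated
  series represents the same \<open>f\<close> and replaces each coefficient by its real part.
\<close>
lemma real_coeff_iff_conj_symmetric_entire:
  "(\<exists>a :: nat \<Rightarrow> real. \<forall>z. (\<lambda>n. of_real (a n) * z ^ n) sums f z) \<longleftrightarrow> f \<in> conj_symmetric_entire"
proof
  assume "\<exists>a :: nat \<Rightarrow> real. \<forall>z. (\<lambda>n. of_real (a n) * z ^ n) sums f z"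
  then obtain a :: "nat \<Rightarrow> real" where a: "\<And>z. (\<lambda>n. of_real (a n) * z ^ n) sums f z"
    by blast
  have "f holomorphic_on ball 0 r" for r
    by (rule power_series_holomorphic[where a = "\<lambda>n. of_real (a n)"]) (use a in simp)
  then have "f analytic_on {z}" for z
    unfolding analytic_at by (intro exI[of _ "ball 0 (norm z + 1)"]) simp
  then have "f holomorphic_on UNIV"
    by (simp add: analytic_on_open[symmetric] analytic_on_analytic_at[of f UNIV])
  moreover have "f (cnj z) = cnj (f z)" for z
  proof -
    have "(\<lambda>n. of_real (a n) * cnj z ^ n) sums cnj (f z)"
      using a[of z] by (subst (asm) sums_cnj[symmetric]) simp
    then show ?thesis
      using a sums_unique2 by blast
  qed
  ultimately show "f \<in> conj_symmetric_entire"
    by (simp add: conj_symmetric_entire_def)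
next
  assume f: "f \<in> conj_symmetric_entire"
  define c where "c = (\<lambda>n. (deriv ^^ n) f 0 / fact n)"
  have c: "(\<lambda>n. c n * z ^ n) sums f z" for z
  proof -
    have "f holomorphic_on ball 0 (norm z + 1)"
      using f by (auto simp: conj_symmetric_entire_def intro: holomorphic_on_subset)
    then show ?thesis
      unfolding c_def using holomorphic_power_series[of f 0 "norm z + 1" z] by simp
  qed
  have "(\<lambda>n. of_real (Re (c n)) * z ^ n) sums f z" for z
  proof -
    have "(\<lambda>n. cnj (c n * cnj z ^ n)) sums cnj (f (cnj z))"
      using c[of "cnj z"] by (simp only: sums_cnj)
    then have "(\<lambda>n. cnj (c n) * z ^ n) sums f z"
      using f by (simp add: conj_symmetric_entire_def)
    then have "(\<lambda>n. (c n * z ^ n + cnj (c n) * z ^ n) / 2) sums ((f z + f z) / 2)"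
      by (intro sums_divide sums_add c)
    moreover have "(c n * z ^ n + cnj (c n) * z ^ n) / 2 = of_real (Re (c n)) * z ^ n" for n
      using complex_add_cnj[of "c n"] by (simp flip: distrib_right)
    ultimately show ?thesis
      by simp
  qed
  then show "\<exists>a :: nat \<Rightarrow> real. \<forall>z. (\<lambda>n. of_real (a n) * z ^ n) sums f z"
    by (intro exI[of _ "\<lambda>n. Re (c n)"] allI)
qed

text \<open>
  If \<open>f = q g\<close> with \<open>f\<close> and \<open>q\<close> commuting with conjugation, then also \<open>f = q g'\<close> for the
  conjugated function \<open>g'\<close>, and the mean of \<open>g\<close> and \<open>g'\<close> is a quotient that commutes with
  conjugation.
\<close>
lemma conj_symmetric_entire_divide:
  assumes f: "f \<in> conj_symmetric_entire" and q: "q \<in> conj_symmetric_entire"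
    and g: "g holomorphic_on UNIV" "f = (\<lambda>z. q z * g z)"
  shows "\<exists>g\<in>conj_symmetric_entire. f = (\<lambda>z. q z * g z)"
proof -
  define k where "k = (\<lambda>z. (g z + cnj (g (cnj z))) / 2)"
  have "cnj \<circ> g \<circ> cnj holomorphic_on UNIV"
    using g by (intro holomorphic_on_compose_cnj_cnj) (auto intro: holomorphic_on_subset)
  then have "(\<lambda>z. cnj (g (cnj z))) holomorphic_on UNIV"
    by (simp add: o_def)
  then have "k holomorphic_on UNIV"
    unfolding k_def using g by (intro holomorphic_intros) auto
  then have "k \<in> conj_symmetric_entire"
    by (simp add: conj_symmetric_entire_def k_def add.commute)
  moreover have "f z = q z * k z" for z
  proof -
    have "f z = cnj (f (cnj z))"
      using f by (simp add: conj_symmetric_entire_def)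
    also have "\<dots> = q z * cnj (g (cnj z))"
      using q g(2) by (simp add: conj_symmetric_entire_def)
    finally show ?thesis
      using g(2) by (simp add: k_def field_simps)
  qed
  ultimately show ?thesis
    by blast
qed

text \<open>
  The values at \<open>p\<close> of the real affine functions exhaust the complex numbers if \<open>p\<close> is not real.
  If \<open>p\<close> is real, then \<open>Im p = 0\<close> and division by zero make \<open>b = 0\<close>, and the constant function
  has the right value because \<open>f p\<close> is real.
\<close>
lemma conj_symmetric_entire_unit_at:
  assumes f: "f \<in> conj_symmetric_entire" and "f p \<noteq> 0"
  shows "\<exists>k\<in>conj_symmetric_entire. f p * k p = 1"
proof -
  define w where "w = inverse (f p)"
  define b where "b = Im w / Im p"
  define k where "k = (\<lambda>z :: complex. of_real (Re w - b * Re p) + of_real b * z)"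
  have "Im w = 0" if "Im p = 0"
  proof -
    have "cnj p = p"
      using that by (simp add: complex_eq_iff)
    then have "cnj (f p) = f p"
      using f by (metis (mono_tags, lifting) conj_symmetric_entire_def mem_Collect_eq)
    then have "cnj w = w"
      by (simp add: w_def)
    then show ?thesis
      by (simp add: complex_eq_iff)
  qed
  then have "k p = w"
    by (auto simp: k_def b_def complex_eq_iff)
  moreover have "k \<in> conj_symmetric_entire"
    unfolding k_def conj_symmetric_entire_def by (auto intro!: holomorphic_intros)
  ultimately show ?thesis
    using \<open>f p \<noteq> 0\<close> by (intro bexI[of _ k]) (auto simp: w_def)
qed

lemma conj_symmetric_entire_vanishing_generator:
  obtains q where "q \<in> conj_symmetric_entire" "q p = 0" "q \<noteq> (\<lambda>_. 0)"
    "\<And>f. f \<in> conj_symmetric_entire \<Longrightarrow> f p = 0 \<Longrightarrow> \<exists>g\<in>conj_symmetric_entire. f = (\<lambda>z. q z * g z)"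
proof (cases "cnj p = p")
  case True
  show thesis
  proof (rule that[of "\<lambda>z. z - p"])
    show symm: "(\<lambda>z. z - p) \<in> conj_symmetric_entire"
      using True by (auto simp: conj_symmetric_entire_def intro!: holomorphic_intros)
    show "(\<lambda>z. z - p) \<noteq> (\<lambda>_. 0)"
      by (auto simp: fun_eq_iff intro: exI[of _ "p + 1"])
    fix f assume f: "f \<in> conj_symmetric_entire" "f p = 0"
    then obtain g where "g \<in> everywhere_analytic" "f = (\<lambda>z. (z - p) * g z)"
      using everywhere_analytic_divide_linear[of f p]
      by (auto simp: conj_symmetric_entire_def everywhere_analytic_complex_iff)
    then show "\<exists>g\<in>conj_symmetric_entire. f = (\<lambda>z. (z - p) * g z)"
      using conj_symmetric_entire_divide[OF f(1) symm] by (simp add: everywhere_analytic_complex_iff)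
  qed simp
next
  case False
  show thesis
  proof (rule that[of "\<lambda>z. (z - p) * (z - cnj p)"])
    show symm: "(\<lambda>z. (z - p) * (z - cnj p)) \<in> conj_symmetric_entire"
      by (auto simp: conj_symmetric_entire_def mult.commute intro!: holomorphic_intros)
    \<comment> \<open>The two zeros lie on a vertical line, so \<open>p + 1\<close> is not a zero.\<close>
    have "p + 1 \<noteq> cnj p"
      by (auto simp: complex_eq_iff)
    then show "(\<lambda>z. (z - p) * (z - cnj p)) \<noteq> (\<lambda>_. 0)"
      by (auto simp: fun_eq_iff intro!: exI[of _ "p + 1"])
    fix f assume f: "f \<in> conj_symmetric_entire" "f p = 0"
    then obtain g where g: "g \<in> everywhere_analytic" "f = (\<lambda>z. (z - p) * g z)"
      using everywhere_analytic_divide_linear[of f p]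
      by (auto simp: conj_symmetric_entire_def everywhere_analytic_complex_iff)
    have "f (cnj p) = 0"
      using f by (simp add: conj_symmetric_entire_def)
    then have "g (cnj p) = 0"
      using g False by simp
    then obtain k where k: "k \<in> everywhere_analytic" "g = (\<lambda>z. (z - cnj p) * k z)"
      using everywhere_analytic_divide_linear g by blast
    then have "f = (\<lambda>z. (z - p) * (z - cnj p) * k z)"
      using g by (simp add: mult.assoc)
    then show "\<exists>g\<in>conj_symmetric_entire. f = (\<lambda>z. (z - p) * (z - cnj p) * g z)"
      using conj_symmetric_entire_divide[OF f(1) symm] k by (simp add: everywhere_analytic_complex_iff)
  qed simp
qed

section \<open>The three rings\<close>

lemma entire_ring_eq: "entire_ring = function_ring everywhere_analytic"
  by (simp add: entire_ring_def everywhere_analytic_complex_iff[symmetric])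

lemma real_analytic_ring_eq: "real_analytic_ring = function_ring everywhere_analytic"
  by (simp add: real_analytic_ring_def everywhere_analytic_def)

lemma real_coeff_entire_ring_eq: "real_coeff_entire_ring = function_ring conj_symmetric_entire"
  by (simp add: real_coeff_entire_ring_def real_coeff_iff_conj_symmetric_entire)

lemma conj_symmetric_entire_fixed_primeideal_maximal:
  assumes "primeideal I (function_ring conj_symmetric_entire)"
    and "I \<noteq> {\<zero>\<^bsub>function_ring conj_symmetric_entire\<^esub>}" and "fixed_ideal I"
  shows "maximalideal I (function_ring conj_symmetric_entire)"
proof -
  have A: "conj_symmetric_entire \<subseteq> everywhere_analytic"
    by (auto simp: conj_symmetric_entire_def everywhere_analytic_complex_iff)
  obtain p where p: "\<And>f. f \<in> I \<Longrightarrow> f p = 0"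
    using assms(3) fixed_idealE by blast
  show ?thesis
  proof (rule conj_symmetric_entire_vanishing_generator[of p],
      rule fixed_primeideal_maximal[OF A assms(1,2), of p])
  qed (simp_all add: p conj_symmetric_entire_unit_at)
qed

theorem proposition2p16:
  shows "(\<forall>I. primeideal I entire_ring \<and> I \<noteq> {\<zero>\<^bsub>entire_ring\<^esub>} \<and> fixed_ideal I
           \<longrightarrow> maximalideal I entire_ring)
       \<and> (\<forall>I. primeideal I real_coeff_entire_ring \<and> I \<noteq> {\<zero>\<^bsub>real_coeff_entire_ring\<^esub>} \<and> fixed_ideal I
           \<longrightarrow> maximalideal I real_coeff_entire_ring)
       \<and> (\<forall>I. primeideal I real_analytic_ring \<and> I \<noteq> {\<zero>\<^bsub>real_analytic_ring\<^esub>} \<and> fixed_ideal I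
           \<longrightarrow> maximalideal I real_analytic_ring)"
  unfolding entire_ring_eq real_coeff_entire_ring_eq real_analytic_ring_eq
  by (intro conjI allI impI; elim conjE)
    (simp_all only: everywhere_analytic_fixed_primeideal_maximal
      conj_symmetric_entire_fixed_primeideal_maximal simp_thms)

end
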